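(* Let $\Phi$ be a continuous distribution function which is asymptotically generalized Gaussian (AGG) on the right with exponent $\gamma\ge 1$. Fix $\beta\in(0,1)$, $r\ge 0$ and $\nu>1$, and let $q=q(n)>0$ satisfy $n^a q(n)\to\infty$ as $n\to\infty$ for every fixed $a>0$. For each $n$, consider the static mixture model with null distribution $\Phi$, mixture weight $\varepsilon=n^{-\beta}$ and shift $\mu=(\gamma r\log n)^{1/\gamma}$, and apply the LORD procedure with the sequence $(\lambda_i)_{i\ge1}$ given by $\lambda_i\propto i^{-\nu}$ and $\sum_{i=1}^\infty\lambda_i=q(n)$. If $r>\nu\beta$, then the false non-discovery rate of LORD on the first $n$ hypotheses satisfies $\mathrm{FNR}_n\to0$ as $n\to\infty$. In particular, if in addition $q(n)\to0$, then the risk $\mathrm{FDR}_n+\mathrm{FNR}_n$ of LORD tends to $0$ as $n\to\infty$.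
   Context: AGG: a distribution function $\Phi$ with $\bar\Phi=1-\Phi$ is asymptotically generalized Gaussian on the right with exponent $\gamma>0$ if $\lim_{x\to\infty}x^{-\gamma}\log\bar\Phi(x)=-1/\gamma$. Static mixture model (parameters $\Phi,\varepsilon,\mu$): there is a stream of null hypotheses $H_1,H_2,\dots$ with independent test statistics $X_1,X_2,\dots$. The $i$-th hypothesis has a shift $\mu_i\in\{0,\mu\}$; the $\mu_i$ are i.i.d. with $\mathbb P(\mu_i=\mu)=\varepsilon$ and $\mathbb P(\mu_i=0)=1-\varepsilon$, and conditionally on $(\mu_i)$ the $X_i$ are independent with $X_i$ having distribution function $\Phi(\cdot-\mu_i)$. The null $H_i$ is true if $\mu_i=0$ and false if $\mu_i=\mu$. The P-values are $P_i=\bar\Phi(X_i)$. The parameters depend on $n$, and performance is measured on the first $n$ hypotheses. Sequential procedures: each procedure uses levels $\alpha_i$ that depend only on $P_1,\dots,P_{i-1}$ (with $\alpha_1$ deterministic), and rejects $H_i$ (makes a discovery at time $i$) if and only if $P_i\le\alpha_i$. LORD: given $\lambda_i\ge0$ with $\sum_i\lambda_i=q$, set $\alpha_i=\lambda_{i-t_i}$, where $t_i=\max\{l<i: H_l\text{ is rejected}\}$, with $t_i=0$ if none of $H_1,\dots,H_{i-1}$ is rejected (in particular $t_1=0$). Error rates: let $F_n\subset\{1,\dots,n\}$ be the set of indices of false nulls and $R_n\subset\{1,\dots,n\}$ the set of indices of rejected hypotheses among the first $n$. Then $\mathrm{FDR}_n=\mathbb E\big[|R_n\setminus F_n|/|R_n|\big]$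 and $\mathrm{FNR}_n=\mathbb E\big[|F_n\setminus R_n|/|F_n|\big]$, with the convention $0/0=0$. *)

theory Defs
  imports "HOL-Probability.Probability"
begin

(* The survival function 1 - Phi is antitone, so if it vanishes somewhere then ln 0 = 0 makes the
   limit below 0 rather than -1/gamma: as in the usual reading, such Phi are not AGG. *)
definition agg_right :: "(real \<Rightarrow> real) \<Rightarrow> real \<Rightarrow> bool" where
  "agg_right \<Phi> \<gamma> \<longleftrightarrow>
     \<gamma> > 0 \<and> ((\<lambda>x. x powr (- \<gamma>) * ln (1 - \<Phi> x)) \<longlongrightarrow> - 1 / \<gamma>) at_top"

(* Hypotheses are numbered from 1; the values of the sequences at index 0 are irrelevant. *)
definition shift_algebra :: "'a measure \<Rightarrow> (nat \<Rightarrow> 'a \<Rightarrow> real) \<Rightarrow> 'a measure" where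
  "shift_algebra M \<theta> =
     sigma (space M) (\<Union>i\<in>{1..}. {\<theta> i -` A \<inter> space M |A. A \<in> sets borel})"

(* cond_law says that, given the whole sequence of shifts \<theta>, the X i are independent with distribution
   functions \<Phi> (. - \<theta> i): their finite-dimensional conditional distribution functions
   are the corresponding products. *)
locale static_mixture = prob_space M
  for M :: "'a measure" +
  fixes \<Phi> :: "real \<Rightarrow> real" and \<epsilon> \<mu> :: real
    and \<theta> X :: "nat \<Rightarrow> 'a \<Rightarrow> real"
  assumes shift_values: "i \<ge> 1 \<Longrightarrow> \<omega> \<in> space M \<Longrightarrow> \<theta> i \<omega> \<in> {0, \<mu>}"
    and indep_shifts: "indep_vars (\<lambda>_. borel) \<theta> {1..}"
    and prob_shift: "i \<ge> 1 \<Longrightarrow> prob {\<omega>\<in>space M. \<theta> i \<omega> = \<mu>} = \<epsilon>"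
    and prob_no_shift: "i \<ge> 1 \<Longrightarrow> prob {\<omega>\<in>space M. \<theta> i \<omega> = 0} = 1 - \<epsilon>"
    and measurable_X: "i \<ge> 1 \<Longrightarrow> random_variable borel (X i)"
    and cond_law: "finite I \<Longrightarrow> I \<subseteq> {1..} \<Longrightarrow>
      AE \<omega> in M.
        real_cond_exp M (shift_algebra M \<theta>)
          (indicator {\<omega>\<in>space M. \<forall>i\<in>I. X i \<omega> \<le> x i}) \<omega>
        = (\<Prod>i\<in>I. \<Phi> (x i - \<theta> i \<omega>))"

definition false_nulls :: "(nat \<Rightarrow> 'a \<Rightarrow> real) \<Rightarrow> real \<Rightarrow> nat \<Rightarrow> 'a \<Rightarrow> nat set" where
  "false_nulls \<theta> \<mu> n \<omega> = {i\<in>{1..n}. \<theta> i \<omega> = \<mu>}"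

definition p_value :: "(real \<Rightarrow> real) \<Rightarrow> (nat \<Rightarrow> 'a \<Rightarrow> real) \<Rightarrow> 'a \<Rightarrow> nat \<Rightarrow> real" where
  "p_value \<Phi> X \<omega> i = 1 - \<Phi> (X i \<omega>)"

definition last_rejection :: "nat set \<Rightarrow> nat" where
  "last_rejection R = (if R = {} then 0 else Max R)"

(* lord_rejected lam p k is the set of indices rejected among the first k; the level used at
   time i is lam (i - t) with t the last rejection time before i. *)
primrec lord_rejected :: "(nat \<Rightarrow> real) \<Rightarrow> (nat \<Rightarrow> real) \<Rightarrow> nat \<Rightarrow> nat set" where
  "lord_rejected lam p 0 = {}"
| "lord_rejected lam p (Suc k) =
     (let R = lord_rejected lam p k
      in if p (Suc k) \<le> lam (Suc k - last_rejection R) then insert (Suc k) R else R)"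

(* Division by zero yields 0, which is the convention 0/0 = 0 for both rates. *)
definition fdr :: "'a measure \<Rightarrow> ('a \<Rightarrow> nat set) \<Rightarrow> ('a \<Rightarrow> nat set) \<Rightarrow> real" where
  "fdr M F R = (\<integral>\<omega>. real (card (R \<omega> - F \<omega>)) / real (card (R \<omega>)) \<partial>M)"

definition fnr :: "'a measure \<Rightarrow> ('a \<Rightarrow> nat set) \<Rightarrow> ('a \<Rightarrow> nat set) \<Rightarrow> real" where
  "fnr M F R = (\<integral>\<omega>. real (card (F \<omega> - R \<omega>)) / real (card (F \<omega>)) \<partial>M)"

definition lord_fdr :: "'a measure \<Rightarrow> (real \<Rightarrow> real) \<Rightarrow> real \<Rightarrow> (nat \<Rightarrow> 'a \<Rightarrow> real)
    \<Rightarrow> (nat \<Rightarrow> 'a \<Rightarrow> real) \<Rightarrow> (nat \<Rightarrow> real) \<Rightarrow> nat \<Rightarrow> real" where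
  "lord_fdr M \<Phi> \<mu> \<theta> X lam n =
     fdr M (false_nulls \<theta> \<mu> n) (\<lambda>\<omega>. lord_rejected lam (p_value \<Phi> X \<omega>) n)"

definition lord_fnr :: "'a measure \<Rightarrow> (real \<Rightarrow> real) \<Rightarrow> real \<Rightarrow> (nat \<Rightarrow> 'a \<Rightarrow> real)
    \<Rightarrow> (nat \<Rightarrow> 'a \<Rightarrow> real) \<Rightarrow> (nat \<Rightarrow> real) \<Rightarrow> nat \<Rightarrow> real" where
  "lord_fnr M \<Phi> \<mu> \<theta> X lam n =
     fnr M (false_nulls \<theta> \<mu> n) (\<lambda>\<omega>. lord_rejected lam (p_value \<Phi> X \<omega>) n)"

end

theory Submission
  imports Defs "HOL-Real_Asymp.Real_Asymp"
begin

text \<open>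
  Choose \<open>\<beta> < b < r / \<nu>\<close>, blocks of length \<open>L \<approx> n\<^sup>b\<close> and \<open>x = (\<gamma> s log n)\<^bsup>1/\<gamma>\<^esup>\<close> with \<open>\<nu> b < s < r\<close>.
  The survival function at \<open>x\<close> is about \<open>n\<^bsup>-s\<^esup>\<close> and hence below \<open>\<lambda>\<^sub>L \<approx> q n\<^bsup>-\<nu>b\<^esup>\<close>, whereas
  \<open>\<delta> = \<Phi> (x - \<mu>) \<rightarrow> 0\<close>. Outside an event of probability at most \<open>(n + 1) (1 - \<epsilon> (1 - \<delta>))\<^sup>L \<rightarrow> 0\<close>
  every block of length \<open>L\<close> contains a false null with \<open>X\<^sub>i > x\<close>; then rejections are never more than \<open>L\<close> apart,
  all levels are at least \<open>\<lambda>\<^sub>L\<close>, and a false null is missed only if \<open>X\<^sub>i \<le> x\<close>, which has conditional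
  probability \<open>\<delta>\<close>. For the FDR, rejections are monotone in the P-values, so a leave-one-out argument
  bounds it by \<open>E[\<Sum> \<alpha>\<^sub>i / max 1 |R\<^sub>n|]\<close>, and the levels sum to at most \<open>q (|R\<^sub>n| + 1)\<close>.
\<close>

section \<open>Rejections and levels of LORD\<close>

lemma last_rejection_mono:
  assumes "finite B" "A \<subseteq> B"
  shows "last_rejection A \<le> last_rejection B"
  using assms by (auto simp: last_rejection_def intro: Max_mono)

lemma last_rejection_less:
  assumes "A \<subseteq> {..<i}" "i > 0"
  shows "last_rejection A < i"
proof -
  have "finite A"
    using assms(1) finite_subset by blast
  then show ?thesis
    using assms by (auto simp: last_rejection_def)
qed

lemma le_last_rejection: "finite A \<Longrightarrow> a \<in> A \<Longrightarrow> a \<le> last_rejection A"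
  by (auto simp: last_rejection_def)

text \<open>Defined for an arbitrary candidate set \<open>T\<close>, not only for the actual
  rejections: the recursion becomes a fixed-point equation in \<open>T\<close>, and for fixed
  \<open>T\<close> the level is a constant independent of the data.\<close>

definition lord_level :: "(nat \<Rightarrow> real) \<Rightarrow> nat set \<Rightarrow> nat \<Rightarrow> real" where
  "lord_level lam T i = lam (i - last_rejection (T \<inter> {..<i}))"

lemma lord_rejected_subset: "lord_rejected lam p k \<subseteq> {1..k}"
  by (induction k) (auto simp: Let_def)

lemma finite_lord_rejected [simp]: "finite (lord_rejected lam p k)"
  by (rule finite_subset[OF lord_rejected_subset]) simp

text \<open>Later steps insert only larger indices, so the final set contains the whole history and
  every past level can be read off it.\<close>

lemma lord_rejected_Int_lessThan:
  "k \<le> n \<Longrightarrow> lord_rejected lam p n \<inter> {..<Suc k} = lord_rejected lam p k"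
proof (induction n)
  case (Suc n)
  show ?case
  proof (cases "k = Suc n")
    case True
    have "lord_rejected lam p (Suc n) \<subseteq> {..<Suc (Suc n)}"
      using lord_rejected_subset[of lam p "Suc n"] by (rule order_trans) auto
    then show ?thesis
      unfolding True by (rule Int_absorb2)
  next
    case False
    then have "lord_rejected lam p (Suc n) \<inter> {..<Suc k} = lord_rejected lam p n \<inter> {..<Suc k}"
      using Suc.prems False by (simp add: Let_def)
    also have "\<dots> = lord_rejected lam p k"
      using Suc.prems False by (intro Suc.IH) auto
    finally show ?thesis .
  qed
qed simp

text \<open>The fixed-point equation of the procedure, which replaces unfolding the recursion from
  here on.\<close>

lemma mem_lord_rejected_iff:
  assumes "i \<in> {1..n}"
  shows "i \<in> lord_rejected lam p n \<longleftrightarrow> p i \<le> lord_level lam (lord_rejected lam p n) i"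
proof -
  obtain k where k: "i = Suc k" "k \<le> n" "Suc k \<le> n"
    using assms by (cases i) auto
  have "i \<in> lord_rejected lam p n \<longleftrightarrow> i \<in> lord_rejected lam p n \<inter> {..<Suc (Suc k)}"
    using k by simp
  also have "\<dots> \<longleftrightarrow> Suc k \<in> lord_rejected lam p (Suc k)"
    unfolding lord_rejected_Int_lessThan[OF k(3)] by (simp only: k(1))
  also have "\<dots> \<longleftrightarrow> p (Suc k) \<le> lam (Suc k - last_rejection (lord_rejected lam p k))"
    using lord_rejected_subset[of lam p k] by (auto simp: Let_def)
  finally show ?thesis
    using lord_rejected_Int_lessThan[OF k(2), of lam p] by (simp add: lord_level_def k(1))
qed

text \<open>The fixed point is unique because the level at \<open>i\<close> sees \<open>T\<close>
  only below \<open>i\<close>, so strong induction on \<open>i\<close> determines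
  membership.\<close>

lemma lord_rejected_eqI:
  assumes T: "T \<subseteq> {1..n}"
    and iff: "\<And>i. i \<in> {1..n} \<Longrightarrow> i \<in> T \<longleftrightarrow> p i \<le> lord_level lam T i"
  shows "lord_rejected lam p n = T"
proof -
  have "i \<in> lord_rejected lam p n \<longleftrightarrow> i \<in> T" for i
  proof (induction i rule: less_induct)
    case (less i)
    then have "lord_rejected lam p n \<inter> {..<i} = T \<inter> {..<i}"
      by auto
    then have "lord_level lam (lord_rejected lam p n) i = lord_level lam T i"
      by (simp add: lord_level_def)
    then show ?case
      using mem_lord_rejected_iff[of i n lam p] iff[of i] T lord_rejected_subset[of lam p n]
      by (cases "i \<in> {1..n}") auto
  qed
  then show ?thesis
    by blast
qed

locale lord_levels =
  fixes lam :: "nat \<Rightarrow> real" and q :: real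
  assumes lam_nonneg: "i \<ge> 1 \<Longrightarrow> 0 \<le> lam i"
    and lam_antimono: "1 \<le> i \<Longrightarrow> i \<le> j \<Longrightarrow> lam j \<le> lam i"
    and sum_lam_le: "(\<Sum>j=1..m. lam j) \<le> q"
begin

lemma lord_level_nonneg: "i \<ge> 1 \<Longrightarrow> 0 \<le> lord_level lam T i"
  unfolding lord_level_def using last_rejection_less[of "T \<inter> {..<i}" i]
  by (intro lam_nonneg) auto

text \<open>Extra earlier rejections can only shorten the time since the last one, and
  \<open>lam\<close> is antitone in that time.\<close>

lemma lord_level_mono:
  assumes "S \<inter> {..<i} \<subseteq> T" "i \<ge> 1"
  shows "lord_level lam S i \<le> lord_level lam T i"
  unfolding lord_level_def
proof (rule lam_antimono)
  show "1 \<le> i - last_rejection (T \<inter> {..<i})"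
    using last_rejection_less[of "T \<inter> {..<i}" i] assms by auto
  show "i - last_rejection (T \<inter> {..<i}) \<le> i - last_rejection (S \<inter> {..<i})"
    using assms by (intro diff_le_mono2 last_rejection_mono) auto
qed

text \<open>By strong induction: smaller P-values give more rejections before \<open>i\<close>,
  hence a larger level at \<open>i\<close>, which is compared with a smaller P-value.\<close>

lemma lord_rejected_mono:
  assumes "\<And>i. i \<in> {1..n} \<Longrightarrow> p' i \<le> p i"
  shows "lord_rejected lam p n \<subseteq> lord_rejected lam p' n"
proof
  fix i assume "i \<in> lord_rejected lam p n"
  then show "i \<in> lord_rejected lam p' n"
  proof (induction i rule: less_induct)
    case (less i)
    have i: "i \<in> {1..n}"
      using less.prems lord_rejected_subset by blast
    have "p' i \<le> p i"
      using assms i by blast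
    also have "\<dots> \<le> lord_level lam (lord_rejected lam p n) i"
      using mem_lord_rejected_iff[OF i] less.prems by blast
    also have "\<dots> \<le> lord_level lam (lord_rejected lam p' n) i"
      using less.IH i by (intro lord_level_mono) auto
    finally show ?case
      using mem_lord_rejected_iff[OF i] by blast
  qed
qed

lemma sum_lord_level_le:
  "(\<Sum>i=1..n. lord_level lam (lord_rejected lam p n) i) \<le> q * (card (lord_rejected lam p n) + 1)"
proof -
  define R where "R = lord_rejected lam p"
  have level: "lord_level lam (R n) (Suc k) = lam (Suc k - last_rejection (R k))" if "k < n" for k
    using that lord_rejected_Int_lessThan[of k n lam p] by (simp add: lord_level_def R_def)
  have last: "last_rejection (R k) \<le> k" for k
  proof -
    have "R k \<subseteq> {..<Suc k}"
      using lord_rejected_subset[of lam p k] by (auto simp: R_def)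
    then show ?thesis
      using last_rejection_less[of "R k" "Suc k"] by simp
  qed
  \<comment> \<open>Each completed run of levels between two rejections sums to at most \<open>q\<close>; the current run is
    kept exactly.\<close>
  have "(\<Sum>i<k. lam (Suc i - last_rejection (R i)))
      \<le> q * card (R k) + (\<Sum>j=1..k - last_rejection (R k). lam j)" for k
  proof (induction k)
    case (Suc k)
    define t where "t = last_rejection (R k)"
    \<comment> \<open>The bound \<open>last\<close> excludes truncated subtraction, so one more time
      step appends exactly one term to the current run.\<close>
    have t: "Suc k - t = Suc (k - t)"
      using last[of k] by (simp add: t_def Suc_diff_le)
    have *: "(\<Sum>i<Suc k. lam (Suc i - last_rejection (R i)))
        \<le> q * card (R k) + (\<Sum>j=1..Suc k - t. lam j)"
      using Suc.IH by (simp add: t t_def[symmetric])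
    show ?case
    proof (cases "Suc k \<in> R (Suc k)")
      case True
      then have R: "R (Suc k) = insert (Suc k) (R k)" "Suc k \<notin> R k"
        using lord_rejected_subset[of lam p k] by (auto simp: R_def Let_def split: if_splits)
      have "last_rejection (R (Suc k)) = Suc k"
        using last[of "Suc k"] le_last_rejection[OF _ True]
        by (intro antisym) (simp_all add: R_def del: lord_rejected.simps)
      then show ?thesis
        using * sum_lam_le[of "Suc k - t"] R by (simp add: R_def algebra_simps)
    next
      case False
      then have "R (Suc k) = R k"
        by (auto simp: R_def Let_def split: if_splits)
      then show ?thesis
        using * by (simp add: t_def)
    qed
  qed (simp add: R_def last_rejection_def)
  \<comment> \<open>The run still open at time \<open>n\<close> costs one further \<open>q\<close>,
    which is the \<open>+ 1\<close> in the claim.\<close>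
  from this[of n] have "(\<Sum>i<n. lord_level lam (R n) (Suc i)) \<le> q * card (R n) + q"
    using sum_lam_le[of "n - last_rejection (R n)"] by (simp add: level)
  also have "(\<Sum>i<n. lord_level lam (R n) (Suc i)) = (\<Sum>i=1..n. lord_level lam (R n) i)"
    by (simp add: sum.atLeast1_atMost_eq)
  finally show ?thesis
    by (simp add: R_def distrib_left)
qed

text \<open>Setting the \<open>i\<close>-th P-value to 0 leaves the history before \<open>i\<close>,
  and so the level at \<open>i\<close>, unchanged. It forces \<open>i\<close> to be rejected and
  loses no rejection, so each denominator is at least \<open>max 1 (card R)\<close> and the bound on
  the sum of levels applies.\<close>

lemma sum_leave_one_out_le:
  assumes "\<And>i. 0 \<le> p i"
  shows "(\<Sum>i=1..n. lord_level lam (lord_rejected lam (p(i := 0)) n) i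
      / card (lord_rejected lam (p(i := 0)) n)) \<le> 2 * q"
proof -
  define R where "R = lord_rejected lam p n"
  define R' where "R' i = lord_rejected lam (p(i := 0)) n" for i
  have q: "q \<ge> 0"
    using sum_lam_le[of 0] by simp
  have "lord_level lam (R' i) i / card (R' i) \<le> lord_level lam R i / max 1 (card R)"
    if i: "i \<in> {1..n}" for i
  proof -
    \<comment> \<open>The two P-value sequences agree up to \<open>i - 1\<close>, so monotonicity
      applies in both directions.\<close>
    have "lord_rejected lam (p(i := 0)) (i - 1) = lord_rejected lam p (i - 1)"
      using i by (intro antisym lord_rejected_mono) auto
    moreover have "lord_rejected lam p' n \<inter> {..<i} = lord_rejected lam p' (i - 1)" for p'
      using i lord_rejected_Int_lessThan[of "i - 1" n lam p'] by (cases i) simp_all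
    ultimately have "R' i \<inter> {..<i} = R \<inter> {..<i}"
      by (simp add: R_def R'_def)
    then have "lord_level lam (R' i) i = lord_level lam R i"
      by (simp add: lord_level_def)
    moreover have "R \<subseteq> R' i"
      using assms unfolding R_def R'_def by (intro lord_rejected_mono) auto
    moreover have "i \<in> R' i"
      using i by (simp add: R'_def mem_lord_rejected_iff lord_level_nonneg)
    ultimately have "max 1 (card R) \<le> card (R' i)" "lord_level lam (R' i) i = lord_level lam R i"
      using card_mono[of "R' i" R] card_mono[of "R' i" "{i}"] by (auto simp: R'_def)
    then show ?thesis
      using i by (auto intro!: divide_left_mono lord_level_nonneg)
  qed
  then have "(\<Sum>i=1..n. lord_level lam (R' i) i / card (R' i))
      \<le> (\<Sum>i=1..n. lord_level lam R i / max 1 (card R))"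
    by (rule sum_mono)
  also have "\<dots> = (\<Sum>i=1..n. lord_level lam R i) / max 1 (card R)"
    by (rule sum_divide_distrib[symmetric])
  also have "\<dots> \<le> q * (card R + 1) / max 1 (card R)"
    using sum_lord_level_le[where n = n and p = p] by (intro divide_right_mono) (auto simp: R_def)
  also have "\<dots> \<le> q * (2 * max 1 (card R)) / max 1 (card R)"
    using q by (intro divide_right_mono mult_left_mono) auto
  also have "\<dots> = 2 * q"
    by simp
  finally show ?thesis
    by (simp add: R'_def)
qed

text \<open>If the last rejection \<open>t\<close> before \<open>i\<close> were more than
  \<open>L\<close> steps back, the window after \<open>t\<close> would contain some
  \<open>j < i\<close> with P-value at most \<open>lam L\<close>. With no rejection in between, the
  level at \<open>j\<close> is \<open>lam (j - t)\<close>, which is at least \<open>lam L\<close>,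
  so \<open>j\<close> would be rejected after \<open>t\<close>, a contradiction.\<close>

lemma lord_level_ge:
  assumes windows: "\<And>t. t \<le> n \<Longrightarrow> \<exists>i\<in>{t<..t+L}. p i \<le> lam L"
    and i: "i \<in> {1..n}"
  shows "lam L \<le> lord_level lam (lord_rejected lam p n) i"
proof -
  define R where "R = lord_rejected lam p n"
  define t where "t = last_rejection (R \<inter> {..<i})"
  have "t < i"
    unfolding t_def using i by (intro last_rejection_less) auto
  have "i - t \<le> L"
  proof (rule ccontr)
    assume "\<not> i - t \<le> L"
    moreover obtain j where j: "j \<in> {t<..t+L}" "p j \<le> lam L"
      using windows[of t] \<open>t < i\<close> i by auto
    ultimately have "j < i"
      by simp linarith
    have "R \<inter> {..<i} = R \<inter> {..<j}"
    proof -
      have "s < j" if "s \<in> R \<inter> {..<i}" for s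
        using le_last_rejection[OF _ that] j by (simp add: t_def)
      then show ?thesis
        using \<open>j < i\<close> by auto
    qed
    then have "lord_level lam R j = lam (j - t)"
      by (simp add: lord_level_def t_def)
    moreover have "lam L \<le> lam (j - t)"
      using j by (intro lam_antimono) auto
    ultimately have "j \<in> R"
      using mem_lord_rejected_iff[of j n lam p] j \<open>j < i\<close> i by (auto simp: R_def)
    then show False
      using le_last_rejection[of "R \<inter> {..<i}" j] j \<open>j < i\<close> by (auto simp: t_def)
  qed
  then have "lam L \<le> lam (i - t)"
    using \<open>t < i\<close> by (intro lam_antimono) auto
  then show ?thesis
    by (simp add: lord_level_def t_def R_def)
qed

end

section \<open>Independence in the mixture model\<close>

text \<open>\<open>D\<close> supplies the limits and monotonicity of \<Phi>; a nonzero shift makes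
  true and false nulls mutually exclusive.\<close>

locale cdf_mixture = static_mixture M \<Phi> \<epsilon> \<mu> \<theta> X + D: real_distribution D
  for M :: "'a measure" and \<Phi> \<epsilon> \<mu> \<theta> X D +
  assumes \<Phi>_eq: "\<Phi> = cdf D"
    and continuous_\<Phi>: "continuous_on UNIV \<Phi>"
    and \<mu>_nonzero: "\<mu> \<noteq> 0"
begin

lemma \<Phi>_nonneg: "0 \<le> \<Phi> x" and \<Phi>_le_1: "\<Phi> x \<le> 1" and \<Phi>_mono: "x \<le> y \<Longrightarrow> \<Phi> x \<le> \<Phi> y"
  by (simp_all add: \<Phi>_eq D.cdf_nonneg D.cdf_bounded_prob D.cdf_nondecreasing)

lemma measurable_\<Phi> [measurable]: "\<Phi> \<in> borel_measurable borel"
  by (rule borel_measurable_continuous_onI[OF continuous_\<Phi>])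

lemma measurable_\<theta>: "i \<ge> 1 \<Longrightarrow> random_variable borel (\<theta> i)"
  using indep_shifts by (simp add: indep_vars_def2)

lemma space_shift_algebra [simp]: "space (shift_algebra M \<theta>) = space M"
  unfolding shift_algebra_def by (rule space_measure_of) auto

lemma sets_shift_algebra:
  "sets (shift_algebra M \<theta>)
    = sigma_sets (space M) (\<Union>i\<in>{1..}. {\<theta> i -` A \<inter> space M |A. A \<in> sets borel})"
  unfolding shift_algebra_def by (rule sets_measure_of) auto

lemma subalgebra_shift_algebra: "subalgebra M (shift_algebra M \<theta>)"
  unfolding subalgebra_def sets_shift_algebra
  by (auto intro!: sets.sigma_sets_subset measurable_sets[OF measurable_\<theta>])

lemma measurable_\<theta>_shift_algebra:
  assumes "i \<ge> 1"
  shows "\<theta> i \<in> borel_measurable (shift_algebra M \<theta>)"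
proof (rule measurableI)
  fix A :: "real set" assume "A \<in> sets borel"
  then show "\<theta> i -` A \<inter> space (shift_algebra M \<theta>) \<in> sets (shift_algebra M \<theta>)"
    using assms unfolding sets_shift_algebra space_shift_algebra
    by (intro sigma_sets.Basic) auto
qed auto

text \<open>The integrated form of \<open>cond_law\<close>, from the defining property of
  conditional expectation: a bounded function of the shifts may be kept as a factor while the events
  on \<open>X\<close> are replaced by their conditional probabilities.\<close>

lemma integral_cond_law:
  fixes f :: "'a \<Rightarrow> real"
  assumes f: "f \<in> borel_measurable (shift_algebra M \<theta>)" and bounded: "\<And>\<omega>. \<bar>f \<omega>\<bar> \<le> B"
    and I: "finite I" "I \<subseteq> {1..}"
  shows "(\<integral>\<omega>. f \<omega> * indicator {\<omega>\<in>space M. \<forall>i\<in>I. X i \<omega> \<le> x i} \<omega> \<partial>M)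
    = (\<integral>\<omega>. f \<omega> * (\<Prod>i\<in>I. \<Phi> (x i - \<theta> i \<omega>)) \<partial>M)"
proof -
  interpret finite_measure_subalgebra M "shift_algebra M \<theta>"
    by unfold_locales (rule subalgebra_shift_algebra)
  let ?E = "{\<omega>\<in>space M. \<forall>i\<in>I. X i \<omega> \<le> x i}"
  have [measurable]: "f \<in> borel_measurable M"
    by (rule measurable_from_subalg[OF subalg f])
  have X: "\<And>i. i \<in> I \<Longrightarrow> X i \<in> borel_measurable M" and \<theta>: "\<And>i. i \<in> I \<Longrightarrow> \<theta> i \<in> borel_measurable M"
    using I measurable_X measurable_\<theta> by auto
  have E [measurable]: "?E \<in> sets M"
    using I(1) X by (intro sets.sets_Collect_finite_All) auto
  have int: "integrable M (\<lambda>\<omega>. f \<omega> * indicator ?E \<omega>)"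
    using bounded by (intro integrable_const_bound[of _ B] AE_I2)
      (auto simp: indicator_def intro: order_trans[OF abs_ge_zero])
  have "(\<integral>\<omega>. f \<omega> * indicator ?E \<omega> \<partial>M)
      = (\<integral>\<omega>. f \<omega> * real_cond_exp M (shift_algebra M \<theta>) (indicator ?E) \<omega> \<partial>M)"
    by (rule real_cond_exp_intg(2)[OF int f, symmetric]) measurable
  also have "\<dots> = (\<integral>\<omega>. f \<omega> * (\<Prod>i\<in>I. \<Phi> (x i - \<theta> i \<omega>)) \<partial>M)"
  proof (rule integral_cong_AE)
    show "(\<lambda>\<omega>. f \<omega> * (\<Prod>i\<in>I. \<Phi> (x i - \<theta> i \<omega>))) \<in> borel_measurable M"
      using \<theta> by (intro borel_measurable_times borel_measurable_prod
          measurable_compose[OF _ measurable_\<Phi>] borel_measurable_diff) auto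
    show "AE \<omega> in M. f \<omega> * real_cond_exp M (shift_algebra M \<theta>) (indicator ?E) \<omega>
        = f \<omega> * (\<Prod>i\<in>I. \<Phi> (x i - \<theta> i \<omega>))"
      using cond_law[OF I, of x] by eventually_elim simp
  qed measurable
  finally show ?thesis .
qed

text \<open>The indicators of the shift constraints are shift-measurable, so
  \<open>integral_cond_law\<close> removes \<open>X\<close>; what is left is a product of functions
  of single shifts, which factorises by their independence.\<close>

lemma prob_rectangle:
  assumes I: "finite I" "I \<subseteq> {1..}" and A: "\<And>i. i \<in> I \<Longrightarrow> A i \<in> sets borel"
  shows "prob {\<omega>\<in>space M. \<forall>i\<in>I. \<theta> i \<omega> \<in> A i \<and> X i \<omega> \<le> x i}
    = (\<Prod>i\<in>I. \<integral>\<omega>. indicator (A i) (\<theta> i \<omega>) * \<Phi> (x i - \<theta> i \<omega>) \<partial>M)"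
proof -
  define f :: "'a \<Rightarrow> real" where "f \<omega> = (\<Prod>i\<in>I. indicator (A i) (\<theta> i \<omega>))" for \<omega>
  have [measurable]: "\<And>i. i \<in> I \<Longrightarrow> \<theta> i \<in> borel_measurable M"
    "\<And>i. i \<in> I \<Longrightarrow> X i \<in> borel_measurable M" and i1: "\<And>i. i \<in> I \<Longrightarrow> i \<ge> 1"
    using I measurable_X measurable_\<theta> by auto
  have f: "f \<in> borel_measurable (shift_algebra M \<theta>)"
    unfolding f_def
  proof (intro borel_measurable_prod)
    fix i assume i: "i \<in> I"
    show "(\<lambda>\<omega>. indicator (A i) (\<theta> i \<omega>) :: real) \<in> borel_measurable (shift_algebra M \<theta>)"
      using measurable_compose[OF measurable_\<theta>_shift_algebra[OF i1[OF i]]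
          borel_measurable_indicator[OF A[OF i]]] .
  qed
  have ind: "f \<omega> * indicator {\<omega>\<in>space M. \<forall>i\<in>I. X i \<omega> \<le> x i} \<omega>
      = indicator {\<omega>\<in>space M. \<forall>i\<in>I. \<theta> i \<omega> \<in> A i \<and> X i \<omega> \<le> x i} \<omega>" for \<omega>
    using I(1) by (auto simp: f_def indicator_def prod_zero_iff)
  have "{\<omega>\<in>space M. \<forall>i\<in>I. \<theta> i \<omega> \<in> A i \<and> X i \<omega> \<le> x i} \<in> sets M"
    using I(1) A by (intro sets.sets_Collect_finite_All) auto
  then have "prob {\<omega>\<in>space M. \<forall>i\<in>I. \<theta> i \<omega> \<in> A i \<and> X i \<omega> \<le> x i}
      = (\<integral>\<omega>. f \<omega> * indicator {\<omega>\<in>space M. \<forall>i\<in>I. X i \<omega> \<le> x i} \<omega> \<partial>M)"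
    unfolding ind by (simp add: Int_absorb2 sets.sets_into_space)
  also have "\<dots> = (\<integral>\<omega>. f \<omega> * (\<Prod>i\<in>I. \<Phi> (x i - \<theta> i \<omega>)) \<partial>M)"
  proof (rule integral_cond_law[OF f _ I])
    show "\<bar>f \<omega>\<bar> \<le> 1" for \<omega>
      unfolding f_def abs_prod by (intro prod_le_1) (auto simp: indicator_def)
  qed
  also have "\<dots> = (\<integral>\<omega>. (\<Prod>i\<in>I. indicator (A i) (\<theta> i \<omega>) * \<Phi> (x i - \<theta> i \<omega>)) \<partial>M)"
    by (simp add: f_def prod.distrib)
  also have "\<dots> = (\<Prod>i\<in>I. \<integral>\<omega>. indicator (A i) (\<theta> i \<omega>) * \<Phi> (x i - \<theta> i \<omega>) \<partial>M)"
  proof (rule indep_vars_lebesgue_integral[OF I(1)])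
    show "indep_vars (\<lambda>_. borel) (\<lambda>i \<omega>. indicator (A i) (\<theta> i \<omega>) * \<Phi> (x i - \<theta> i \<omega>)) I"
    proof (rule indep_vars_compose2[where Y = "\<lambda>i t. indicator (A i) t * \<Phi> (x i - t)"])
      show "indep_vars (\<lambda>_. borel) \<theta> I"
        by (rule indep_vars_subset[OF indep_shifts I(2)])
    qed (use A in measurable)
    fix i assume "i \<in> I"
    then show "integrable M (\<lambda>\<omega>. indicator (A i) (\<theta> i \<omega>) * \<Phi> (x i - \<theta> i \<omega>))"
      using A \<Phi>_nonneg \<Phi>_le_1
      by (intro integrable_const_bound[of _ 1] AE_I2) (auto simp: indicator_def)
  qed
  finally show ?thesis .
qed

lemma prob_shift_and_le:
  assumes "i \<ge> 1"
  shows "prob {\<omega>\<in>space M. \<theta> i \<omega> = v \<and> X i \<omega> \<le> x} = prob {\<omega>\<in>space M. \<theta> i \<omega> = v} * \<Phi> (x - v)"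
proof -
  have [measurable]: "\<theta> i \<in> borel_measurable M"
    using assms by (rule measurable_\<theta>)
  have "prob {\<omega>\<in>space M. \<theta> i \<omega> = v \<and> X i \<omega> \<le> x}
      = (\<integral>\<omega>. indicator {v} (\<theta> i \<omega>) * \<Phi> (x - \<theta> i \<omega>) \<partial>M)"
    using prob_rectangle[of "{i}" "\<lambda>_. {v}" "\<lambda>_. x"] assms by simp
  also have "\<dots> = (\<integral>\<omega>. indicator {\<omega>\<in>space M. \<theta> i \<omega> = v} \<omega> * \<Phi> (x - v) \<partial>M)"
    by (intro Bochner_Integration.integral_cong) (auto simp: indicator_def)
  also have "\<dots> = prob {\<omega>\<in>space M. \<theta> i \<omega> = v} * \<Phi> (x - v)"
    by simp
  finally show ?thesis .
qed

text \<open>The events \<open>E i\<close> form an intersection-stable generator for the pair, and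
  \<open>prob_rectangle\<close> gives the product formula on them, so independence passes to the
  generated sigma-algebras.\<close>

lemma indep_vars_pairs: "indep_vars (\<lambda>_. borel) (\<lambda>i \<omega>. (\<theta> i \<omega>, X i \<omega>)) {1..}"
proof -
  define E where "E i = {{\<omega>\<in>space M. \<theta> i \<omega> \<in> A \<and> X i \<omega> \<le> x} |A x. A \<in> sets borel}" for i
  have "indep_sets E {1..}"
  proof (rule indep_setsI)
    fix i :: nat assume "i \<in> {1..}"
    then have [measurable]: "\<theta> i \<in> borel_measurable M" "X i \<in> borel_measurable M"
      using measurable_X measurable_\<theta> by auto
    show "E i \<subseteq> events"
      by (auto simp: E_def)
  next
    fix C and J :: "nat set"
    assume J: "J \<noteq> {}" "J \<subseteq> {1..}" "finite J" "\<forall>j\<in>J. C j \<in> E j"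
    have "\<forall>j\<in>J. \<exists>A x. A \<in> sets borel \<and> C j = {\<omega>\<in>space M. \<theta> j \<omega> \<in> A \<and> X j \<omega> \<le> x}"
    proof
      fix j assume "j \<in> J"
      then have "C j \<in> E j"
        using J(4) by blast
      then show "\<exists>A x. A \<in> sets borel \<and> C j = {\<omega>\<in>space M. \<theta> j \<omega> \<in> A \<and> X j \<omega> \<le> x}"
        unfolding E_def by blast
    qed
    then obtain A x where A: "\<And>j. j \<in> J \<Longrightarrow> A j \<in> sets borel"
        "\<And>j. j \<in> J \<Longrightarrow> C j = {\<omega>\<in>space M. \<theta> j \<omega> \<in> A j \<and> X j \<omega> \<le> x j}"
      by metis
    have "(\<Inter>j\<in>J. C j) = {\<omega>\<in>space M. \<forall>j\<in>J. \<theta> j \<omega> \<in> A j \<and> X j \<omega> \<le> x j}"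
      using A(2) J(1) by auto
    then have "prob (\<Inter>j\<in>J. C j)
        = (\<Prod>j\<in>J. \<integral>\<omega>. indicator (A j) (\<theta> j \<omega>) * \<Phi> (x j - \<theta> j \<omega>) \<partial>M)"
      using prob_rectangle[OF J(3,2), of A x] A(1) by simp
    also have "\<dots> = (\<Prod>j\<in>J. prob (C j))"
    proof (rule prod.cong[OF refl])
      fix j assume "j \<in> J"
      \<comment> \<open>The case of a single index turns each factor back into a
        probability.\<close>
      then show "(\<integral>\<omega>. indicator (A j) (\<theta> j \<omega>) * \<Phi> (x j - \<theta> j \<omega>) \<partial>M) = prob (C j)"
        using prob_rectangle[of "{j}" A x] A[of j] J(2) by auto
    qed
    finally show "prob (\<Inter>j\<in>J. C j) = (\<Prod>j\<in>J. prob (C j))" .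
  qed
  moreover have "Int_stable (E i)" for i
  proof (rule Int_stableI)
    fix a b assume "a \<in> E i" "b \<in> E i"
    then obtain A x A' x' where "A \<in> sets borel" "A' \<in> sets borel"
        "a = {\<omega>\<in>space M. \<theta> i \<omega> \<in> A \<and> X i \<omega> \<le> x}" "b = {\<omega>\<in>space M. \<theta> i \<omega> \<in> A' \<and> X i \<omega> \<le> x'}"
      by (auto simp: E_def)
    then have "A \<inter> A' \<in> sets borel" "a \<inter> b = {\<omega>\<in>space M. \<theta> i \<omega> \<in> A \<inter> A' \<and> X i \<omega> \<le> min x x'}"
      by auto
    then show "a \<inter> b \<in> E i"
      unfolding E_def by blast
  qed
  ultimately have indep: "indep_sets (\<lambda>i. sigma_sets (space M) (E i)) {1..}"
    by (rule indep_sets_sigma)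
  show ?thesis
    unfolding indep_vars_def2
  proof (intro conjI ballI)
    fix i :: nat assume "i \<in> {1..}"
    then have [measurable]: "\<theta> i \<in> borel_measurable M" "X i \<in> borel_measurable M"
      using measurable_X measurable_\<theta> by auto
    show "random_variable borel (\<lambda>\<omega>. (\<theta> i \<omega>, X i \<omega>))"
      by measurable
  next
    show "indep_sets (\<lambda>i. {(\<lambda>\<omega>. (\<theta> i \<omega>, X i \<omega>)) -` A \<inter> space M |A. A \<in> sets borel}) {1..}"
    proof (rule indep_sets_mono_sets[OF indep])
      fix i :: nat assume "i \<in> {1..}"
      \<comment> \<open>It remains to see that the pair is measurable for \<open>?N\<close>, so that
        its preimages lie in the independent sigma-algebras.\<close>
      let ?N = "sigma (space M) (E i)"
      have N: "space ?N = space M" "sets ?N = sigma_sets (space M) (E i)"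
        by (auto simp: E_def intro!: space_measure_of sets_measure_of)
      have "\<theta> i \<in> borel_measurable ?N"
      proof (rule measurableI)
        fix A :: "real set" assume A: "A \<in> sets borel"
        \<comment> \<open>Generators always bound \<open>X i\<close> from above; the union over
          integer bounds removes that constraint.\<close>
        have "\<theta> i -` A \<inter> space ?N = (\<Union>k::nat. {\<omega>\<in>space M. \<theta> i \<omega> \<in> A \<and> X i \<omega> \<le> real k})"
          using real_arch_simple by (auto simp: N)
        moreover have "{\<omega>\<in>space M. \<theta> i \<omega> \<in> A \<and> X i \<omega> \<le> real k} \<in> sets ?N" for k
          using A unfolding N by (intro sigma_sets.Basic) (auto simp: E_def)
        ultimately show "\<theta> i -` A \<inter> space ?N \<in> sets ?N"
          by auto
      qed simp
      moreover have "X i \<in> borel_measurable ?N"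
        unfolding borel_measurable_iff_le
      proof
        fix a
        have "{\<omega>\<in>space M. X i \<omega> \<le> a} \<in> E i"
          unfolding E_def by (auto intro!: exI[of _ UNIV])
        then show "{\<omega> \<in> space ?N. X i \<omega> \<le> a} \<in> sets ?N"
          unfolding N by (rule sigma_sets.Basic)
      qed
      ultimately have "(\<lambda>\<omega>. (\<theta> i \<omega>, X i \<omega>)) \<in> borel_measurable ?N"
        by measurable
      then show "{(\<lambda>\<omega>. (\<theta> i \<omega>, X i \<omega>)) -` A \<inter> space M |A. A \<in> sets borel}
          \<subseteq> sigma_sets (space M) (E i)"
        using measurable_sets[of "\<lambda>\<omega>. (\<theta> i \<omega>, X i \<omega>)" ?N borel] by (auto simp: N)
    qed
  qed
qed

text \<open>Independence of the pairs, in the form used below for predicates that vary with the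
  index; the product rule for independent variables is applied for nonempty \<open>J\<close>, so the
  empty case is separate.\<close>

lemma prob_Collect_Ball:
  assumes J: "finite J" "J \<subseteq> {1..}" and P: "\<And>i. i \<in> J \<Longrightarrow> Measurable.pred borel (P i)"
  shows "prob {\<omega>\<in>space M. \<forall>i\<in>J. P i (\<theta> i \<omega>, X i \<omega>)}
    = (\<Prod>i\<in>J. prob {\<omega>\<in>space M. P i (\<theta> i \<omega>, X i \<omega>)})"
proof (cases "J = {}")
  case False
  let ?Y = "\<lambda>i \<omega>. (\<theta> i \<omega>, X i \<omega>)"
  have "prob (\<Inter>i\<in>J. ?Y i -` {y. P i y} \<inter> space M) = (\<Prod>i\<in>J. prob (?Y i -` {y. P i y} \<inter> space M))"
    using P by (intro indep_varsD[OF indep_vars_pairs False J]) (auto simp: pred_def)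
  moreover have "?Y i -` {y. P i y} \<inter> space M = {\<omega>\<in>space M. P i (\<theta> i \<omega>, X i \<omega>)}" for i
    by auto
  moreover have "(\<Inter>i\<in>J. {\<omega>\<in>space M. P i (\<theta> i \<omega>, X i \<omega>)}) = {\<omega>\<in>space M. \<forall>i\<in>J. P i (\<theta> i \<omega>, X i \<omega>)}"
    using False by auto
  ultimately show ?thesis
    by (simp only:)
qed (simp add: prob_space)

section \<open>Error bounds for fixed parameters\<close>

lemma \<Phi>_attains:
  assumes "0 < s" "s < 1"
  obtains y where "\<Phi> y = s"
proof -
  have "eventually (\<lambda>y. \<Phi> y < s) at_bot"
    using D.cdf_lim_at_bot assms(1) unfolding \<Phi>_eq by (rule order_tendstoD)
  then obtain u where u: "\<Phi> u < s"
    using eventually_happens'[of at_bot] by force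
  have "eventually (\<lambda>y. s < \<Phi> y) at_top"
    using D.cdf_lim_at_top_prob assms(2) unfolding \<Phi>_eq by (rule order_tendstoD)
  then obtain v where v: "s < \<Phi> v"
    using eventually_happens'[of at_top] by force
  have "u \<le> v"
    using u v \<Phi>_mono[of v u] by linarith
  then show thesis
    using IVT'[of \<Phi> u s v] u v continuous_on_subset[OF continuous_\<Phi>] that by auto
qed

lemma prob_shift_and_greater:
  assumes "i \<ge> 1"
  shows "prob {\<omega>\<in>space M. \<theta> i \<omega> = v \<and> y < X i \<omega>}
    = prob {\<omega>\<in>space M. \<theta> i \<omega> = v} * (1 - \<Phi> (y - v))"
proof -
  have [measurable]: "\<theta> i \<in> borel_measurable M" "X i \<in> borel_measurable M"
    using assms by (auto intro: measurable_\<theta> measurable_X)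
  have "prob {\<omega>\<in>space M. \<theta> i \<omega> = v}
      = prob {\<omega>\<in>space M. \<theta> i \<omega> = v \<and> y < X i \<omega>} + prob {\<omega>\<in>space M. \<theta> i \<omega> = v \<and> X i \<omega> \<le> y}"
    by (subst finite_measure_Union[symmetric]) (auto intro!: arg_cong[where f = prob])
  then show ?thesis
    by (simp add: prob_shift_and_le[OF assms] algebra_simps)
qed

text \<open>Otherwise some \<open>s\<close> lies strictly between \<open>1 - prob ?E\<close> and
  \<open>1 - a\<close>, and continuity gives \<open>y\<close> with \<open>\<Phi> y = s\<close>. A
  P-value at most \<open>a\<close> forces \<open>X i\<close> above \<open>y\<close>, an event of
  null probability at most \<open>1 - s\<close>, which is less than \<open>prob ?E\<close>.\<close>

lemma null_p_value_superuniform: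
  assumes "i \<ge> 1" "0 \<le> a"
  shows "prob {\<omega>\<in>space M. \<theta> i \<omega> = 0 \<and> 1 - \<Phi> (X i \<omega>) \<le> a} \<le> a" (is "prob ?E \<le> a")
proof (rule ccontr)
  assume "\<not> prob ?E \<le> a"
  then have "max 0 (1 - prob ?E) < 1 - a"
    using prob_le_1[of ?E] by linarith
  then obtain s where s: "max 0 (1 - prob ?E) < s" "s < 1 - a"
    using dense by blast
  have "0 < s" "s < 1"
    using le_less_trans[OF max.cobounded1 s(1)] s(2) assms(2) by linarith+
  then obtain y where y: "\<Phi> y = s"
    by (rule \<Phi>_attains)
  have [measurable]: "\<theta> i \<in> borel_measurable M" "X i \<in> borel_measurable M"
    using assms by (auto intro: measurable_\<theta> measurable_X)
  have "y < X i \<omega>" if "1 - \<Phi> (X i \<omega>) \<le> a" for \<omega>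
    using that s y \<Phi>_mono[of "X i \<omega>" y] by linarith
  then have "prob ?E \<le> prob {\<omega>\<in>space M. \<theta> i \<omega> = 0 \<and> y < X i \<omega>}"
    by (intro finite_measure_mono) auto
  also have "\<dots> = prob {\<omega>\<in>space M. \<theta> i \<omega> = 0} * (1 - s)"
    by (simp add: prob_shift_and_greater[OF assms(1)] y)
  also have "\<dots> \<le> 1 - s"
    using s assms(2) by (intro mult_left_le_one_le) auto
  finally show False
    using s by linarith
qed

lemma not_\<mu>_iff: "i \<ge> 1 \<Longrightarrow> \<omega> \<in> space M \<Longrightarrow> \<theta> i \<omega> \<noteq> \<mu> \<longleftrightarrow> \<theta> i \<omega> = 0"
  using shift_values[of i \<omega>] \<mu>_nonzero by auto

lemma fdr_nonneg: "0 \<le> lord_fdr M \<Phi> \<mu> \<theta> X lam n"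
  and fnr_nonneg: "0 \<le> lord_fnr M \<Phi> \<mu> \<theta> X lam n"
  unfolding lord_fdr_def lord_fnr_def fdr_def fnr_def by (auto intro!: integral_nonneg)

text \<open>Decompose over the rejection set \<open>T\<close>: for \<open>i \<in> T\<close>, the event that \<open>T\<close> is the rejection set is
  \<open>p\<^sub>i \<le> level T i\<close> together with \<open>B T i\<close>, which does not involve \<open>X\<^sub>i\<close> and says that \<open>T\<close> would be the
  rejection set if \<open>p\<^sub>i\<close> were \<open>0\<close>.\<close>

lemma lord_fdr_le:
  assumes "lord_levels lam q"
  shows "lord_fdr M \<Phi> \<mu> \<theta> X lam n \<le> 2 * q"
proof -
  interpret lord_levels lam q by fact
  define p where "p = p_value \<Phi> X"
  define R where "R \<omega> = lord_rejected lam (p \<omega>) n" for \<omega>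
  define level where "level = lord_level lam"
  define B where "B T i = {\<omega>\<in>space M. \<forall>k\<in>{1..n}-{i}. k \<in> T \<longleftrightarrow> p \<omega> k \<le> level T k}" for T i
  define C where "C T i = {\<omega>\<in>space M. \<theta> i \<omega> = 0 \<and> p \<omega> i \<le> level T i}" for T i
  have p_measurable: "(\<lambda>\<omega>. p \<omega> k) \<in> borel_measurable M" if "k \<ge> 1" for k
    unfolding p_def p_value_def using measurable_X[OF that] by measurable
  have B [measurable]: "B T i \<in> sets M" for T i
    unfolding B_def using p_measurable by (intro sets.sets_Collect_finite_All) auto
  have C [measurable]: "C T i \<in> sets M" if "i \<ge> 1" for T i
    unfolding C_def using p_measurable[OF that] measurable_\<theta>[OF that] by measurable
  \<comment> \<open>With \<open>T\<close> fixed, \<open>C T i\<close> concerns only coordinate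
    \<open>i\<close> and \<open>B T i\<close> only the others, so the probability factorises and
    superuniformity bounds the first factor.\<close>
  have prob_CB: "prob (C T i \<inter> B T i) \<le> level T i * prob (B T i)" if i: "i \<in> {1..n}" for T i
  proof -
    define P :: "nat \<Rightarrow> real \<times> real \<Rightarrow> bool" where "P k = (if k = i then (\<lambda>y. fst y = 0 \<and> 1 - \<Phi> (snd y) \<le> level T i)
      else (\<lambda>y. k \<in> T \<longleftrightarrow> 1 - \<Phi> (snd y) \<le> level T k))" for k
    have P: "Measurable.pred borel (P k)" for k
      unfolding P_def borel_prod[symmetric] by (cases "k = i") auto
    have CB: "C T i \<inter> B T i = {\<omega>\<in>space M. \<forall>k\<in>{1..n}. P k (\<theta> k \<omega>, X k \<omega>)}"
      using i by (auto simp: C_def B_def P_def p_def p_value_def)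
    have Bi: "B T i = {\<omega>\<in>space M. \<forall>k\<in>{1..n}-{i}. P k (\<theta> k \<omega>, X k \<omega>)}"
      by (auto simp: B_def P_def p_def p_value_def)
    have "prob (C T i \<inter> B T i) = (\<Prod>k=1..n. prob {\<omega>\<in>space M. P k (\<theta> k \<omega>, X k \<omega>)})"
      unfolding CB by (rule prob_Collect_Ball) (auto intro: P)
    also have "\<dots> = prob {\<omega>\<in>space M. P i (\<theta> i \<omega>, X i \<omega>)}
        * (\<Prod>k\<in>{1..n}-{i}. prob {\<omega>\<in>space M. P k (\<theta> k \<omega>, X k \<omega>)})"
      using i by (intro prod.remove) auto
    also have "(\<Prod>k\<in>{1..n}-{i}. prob {\<omega>\<in>space M. P k (\<theta> k \<omega>, X k \<omega>)}) = prob (B T i)"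
      unfolding Bi by (rule prob_Collect_Ball[symmetric]) (auto intro: P)
    also have "prob {\<omega>\<in>space M. P i (\<theta> i \<omega>, X i \<omega>)} * prob (B T i) \<le> level T i * prob (B T i)"
      using i null_p_value_superuniform[of i "level T i"]
      by (intro mult_right_mono) (auto simp: P_def level_def lord_level_nonneg)
    finally show ?thesis .
  qed
  \<comment> \<open>Summing over all fixed subsets \<open>T\<close> makes the levels constants.
    \<open>f\<close> dominates the false discovery proportion because \<open>R \<omega>\<close> is
    one of the \<open>T\<close>; \<open>g\<close> results from trading coordinate \<open>i\<close>
    for the factor \<open>level T i\<close> by \<open>prob_CB\<close>.\<close>
  define f where "f \<omega> = (\<Sum>T\<in>Pow {1..n}. \<Sum>i\<in>T. indicator (C T i \<inter> B T i) \<omega> / card T)" for \<omega> :: 'a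
  define g where "g \<omega> = (\<Sum>T\<in>Pow {1..n}. \<Sum>i\<in>T. level T i * indicator (B T i) \<omega> / card T)" for \<omega> :: 'a
  have int_f: "integrable M f"
    unfolding f_def
    by (intro Bochner_Integration.integrable_sum Bochner_Integration.integrable_divide
        integrable_real_indicator) (auto simp: less_top[symmetric])
  have int_g: "integrable M g"
    unfolding g_def
    by (intro Bochner_Integration.integrable_sum Bochner_Integration.integrable_divide
        integrable_mult_right integrable_real_indicator) (auto simp: less_top[symmetric])
  have "lord_fdr M \<Phi> \<mu> \<theta> X lam n \<le> (\<integral>\<omega>. f \<omega> \<partial>M)"
    unfolding lord_fdr_def fdr_def p_def[symmetric] R_def[symmetric]
  proof (rule integral_mono'[OF int_f])
    fix \<omega> assume \<omega>: "\<omega> \<in> space M"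
    show "0 \<le> f \<omega>"
      unfolding f_def by (intro sum_nonneg) auto
    let ?F = "false_nulls \<theta> \<mu> n \<omega>"
    have R: "R \<omega> \<subseteq> {1..n}" "finite (R \<omega>)"
      unfolding R_def by (rule lord_rejected_subset, simp)
    have "real (card (R \<omega> - ?F)) / card (R \<omega>) = (\<Sum>i\<in>R \<omega>. of_bool (i \<notin> ?F) / card (R \<omega>))"
      using R(2) by (simp add: sum_divide_distrib[symmetric] sum_of_bool_eq set_diff_eq Int_def)
    also have "\<dots> \<le> (\<Sum>i\<in>R \<omega>. indicator (C (R \<omega>) i \<inter> B (R \<omega>) i) \<omega> / card (R \<omega>))"
    proof (rule sum_mono)
      fix i assume i: "i \<in> R \<omega>"
      then have "i \<in> {1..n}"
        using R(1) by blast
      moreover have "k \<in> R \<omega> \<longleftrightarrow> p \<omega> k \<le> level (R \<omega>) k" if "k \<in> {1..n}" for k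
        using mem_lord_rejected_iff[OF that] by (simp add: R_def level_def)
      ultimately have "\<omega> \<in> C (R \<omega>) i \<inter> B (R \<omega>) i" if "i \<notin> ?F"
        using that \<omega> i not_\<mu>_iff[of i \<omega>] by (auto simp: C_def B_def false_nulls_def)
      then show "of_bool (i \<notin> ?F) / real (card (R \<omega>))
          \<le> indicator (C (R \<omega>) i \<inter> B (R \<omega>) i) \<omega> / card (R \<omega>)"
        by (intro divide_right_mono) (auto simp: of_bool_def)
    qed
    also have "\<dots> \<le> f \<omega>"
      unfolding f_def using R(1)
      by (intro member_le_sum[where f = "\<lambda>T. \<Sum>i\<in>T. indicator (C T i \<inter> B T i) \<omega> / card T"])
        (auto intro!: sum_nonneg)
    finally show "real (card (R \<omega> - ?F)) / real (card (R \<omega>)) \<le> f \<omega>" .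
  qed
  also have "(\<integral>\<omega>. f \<omega> \<partial>M) = (\<Sum>T\<in>Pow {1..n}. \<Sum>i\<in>T. prob (C T i \<inter> B T i) / card T)"
    unfolding f_def
    by (subst Bochner_Integration.integral_sum;
        (intro sum.cong refl)?, (subst Bochner_Integration.integral_sum)?)
      (auto intro!: sum.cong Bochner_Integration.integrable_sum Bochner_Integration.integrable_divide
        integrable_real_indicator simp: less_top[symmetric])
  also have "\<dots> \<le> (\<Sum>T\<in>Pow {1..n}. \<Sum>i\<in>T. level T i * prob (B T i) / card T)"
    using prob_CB by (intro sum_mono divide_right_mono) auto
  also have "\<dots> = (\<integral>\<omega>. g \<omega> \<partial>M)"
    unfolding g_def
    by (subst Bochner_Integration.integral_sum;
        (intro sum.cong refl)?, (subst Bochner_Integration.integral_sum)?)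
      (auto intro!: sum.cong Bochner_Integration.integrable_sum Bochner_Integration.integrable_divide
        integrable_real_indicator simp: less_top[symmetric])
  also have "\<dots> \<le> 2 * q"
  proof (rule integral_le_const[OF int_g AE_I2])
    fix \<omega> assume \<omega>: "\<omega> \<in> space M"
    define R' where "R' i = lord_rejected lam ((p \<omega>)(i := 0)) n" for i
    have "g \<omega> = (\<Sum>T\<in>Pow {1..n}. \<Sum>i\<in>{i\<in>{1..n}. i \<in> T}. level T i * indicator (B T i) \<omega> / card T)"
      unfolding g_def by (intro sum.cong) auto
    also have "\<dots> = (\<Sum>i=1..n. \<Sum>T\<in>{T\<in>Pow {1..n}. i \<in> T}. level T i * indicator (B T i) \<omega> / card T)"
      by (rule sum.swap_restrict) auto
    also have "\<dots> \<le> (\<Sum>i=1..n. level (R' i) i / card (R' i))"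
    proof (rule sum_mono)
      fix i assume i: "i \<in> {1..n}"
      \<comment> \<open>For given \<open>i\<close> and \<omega> at most one \<open>T\<close>
        contributes: it solves the fixed-point equation with the \<open>i\<close>-th P-value set to
        0. This collapses the inner sum to the leave-one-out term.\<close>
      have unique: "T = R' i" if "T \<subseteq> {1..n}" "i \<in> T" "\<omega> \<in> B T i" for T
      proof -
        have "k \<in> T \<longleftrightarrow> ((p \<omega>)(i := 0)) k \<le> lord_level lam T k" if "k \<in> {1..n}" for k
          using that \<open>i \<in> T\<close> \<open>\<omega> \<in> B T i\<close> lord_level_nonneg[of i T]
          by (cases "k = i") (auto simp: B_def level_def)
        then show ?thesis
          unfolding R'_def by (intro lord_rejected_eqI[symmetric] \<open>T \<subseteq> {1..n}\<close>)
      qed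
      have "(\<Sum>T\<in>{T\<in>Pow {1..n}. i \<in> T}. level T i * indicator (B T i) \<omega> / card T)
          \<le> (\<Sum>T\<in>{T\<in>Pow {1..n}. i \<in> T}. if T = R' i then level (R' i) i / card (R' i) else 0)"
      proof (rule sum_mono)
        fix T assume T: "T \<in> {T\<in>Pow {1..n}. i \<in> T}"
        show "level T i * indicator (B T i) \<omega> / card T
            \<le> (if T = R' i then level (R' i) i / card (R' i) else 0)"
        proof (cases "\<omega> \<in> B T i")
          case True
          then have "T = R' i"
            using unique T by auto
          then show ?thesis
            using True by simp
        next
          case False
          have "0 \<le> level (R' i) i / card (R' i)"
            using i by (intro divide_nonneg_nonneg) (simp_all add: level_def lord_level_nonneg)
          then show ?thesis
            using False by simp
        qed
      qed
      also have "\<dots> \<le> level (R' i) i / card (R' i)"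
      proof -
        have "0 \<le> level (R' i) i / card (R' i)"
          using i by (intro divide_nonneg_nonneg) (simp_all add: level_def lord_level_nonneg)
        then show ?thesis
          by (subst sum.delta) simp_all
      qed
      finally show "(\<Sum>T\<in>{T\<in>Pow {1..n}. i \<in> T}. level T i * indicator (B T i) \<omega> / card T)
          \<le> level (R' i) i / card (R' i)" .
    qed
    also have "\<dots> \<le> 2 * q"
      unfolding R'_def level_def
      by (rule sum_leave_one_out_le) (simp add: p_def p_value_def \<Phi>_le_1)
    finally show "g \<omega> \<le> 2 * q" .
  qed
  finally show ?thesis .
qed

text \<open>The first summand is a union bound over the \<open>n + 1\<close> windows that might lack
  a false null with statistic above \<open>x\<close>. Outside this event all levels are at least
  \<open>lam L\<close>, so a missed false null has statistic at most \<open>x\<close>, which has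
  conditional probability \<open>\<Phi> (x - \<mu>)\<close>.\<close>

lemma lord_fnr_le:
  assumes "lord_levels lam q" and L: "1 - \<Phi> x \<le> lam L"
  shows "lord_fnr M \<Phi> \<mu> \<theta> X lam n
    \<le> real (n + 1) * (1 - \<epsilon> * (1 - \<Phi> (x - \<mu>))) ^ L + \<Phi> (x - \<mu>)"
proof -
  interpret lord_levels lam q by fact
  define p where "p = p_value \<Phi> X"
  define R where "R \<omega> = lord_rejected lam (p \<omega>) n" for \<omega>
  define F where "F = false_nulls \<theta> \<mu> n"
  \<comment> \<open>Windows starting near \<open>n\<close> reach beyond \<open>n\<close>; the model
    describes the whole stream, so all have the same probability.\<close>
  define W where "W t = {\<omega>\<in>space M. \<forall>i\<in>{t<..t+L}. \<not> (\<theta> i \<omega> = \<mu> \<and> x < X i \<omega>)}" for t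
  \<comment> \<open>The weight of \<open>i\<close> in the false non-discovery proportion if
    \<open>i\<close> is a false null, and 0 otherwise. It depends on the shifts alone, so
    \<open>integral_cond_law\<close> applies to it.\<close>
  define h :: "nat \<Rightarrow> 'a \<Rightarrow> real" where "h i \<omega> = indicator {\<mu>} (\<theta> i \<omega>) / (\<Sum>j=1..n. indicator {\<mu>} (\<theta> j \<omega>))" for i \<omega>
  have card_F: "real (card (F \<omega>)) = (\<Sum>j=1..n. indicator {\<mu>} (\<theta> j \<omega>))" for \<omega>
    by (simp add: F_def false_nulls_def indicator_def Int_def flip: of_bool_def)
  have W [measurable]: "W t \<in> sets M" for t
    unfolding W_def using measurable_\<theta> measurable_X
    by (intro sets.sets_Collect_finite_All) auto
  have prob_W: "prob (W t) = (1 - \<epsilon> * (1 - \<Phi> (x - \<mu>))) ^ L" for t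
  proof -
    define P :: "real \<times> real \<Rightarrow> bool" where "P y \<longleftrightarrow> \<not> (fst y = \<mu> \<and> x < snd y)" for y
    have P: "Measurable.pred borel P"
      unfolding P_def borel_prod[symmetric] by measurable
    have "prob (W t) = prob {\<omega>\<in>space M. \<forall>i\<in>{t<..t+L}. P (\<theta> i \<omega>, X i \<omega>)}"
      by (simp add: W_def P_def)
    also have "\<dots> = (\<Prod>i\<in>{t<..t+L}. prob {\<omega>\<in>space M. P (\<theta> i \<omega>, X i \<omega>)})"
      using P by (intro prob_Collect_Ball) auto
    also have "\<dots> = (\<Prod>i\<in>{t<..t+L}. 1 - \<epsilon> * (1 - \<Phi> (x - \<mu>)))"
    proof (rule prod.cong[OF refl])
      fix i assume "i \<in> {t<..t+L}"
      then have i: "i \<ge> 1"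
        by simp
      note [measurable] = measurable_\<theta>[OF i] measurable_X[OF i]
      have "{\<omega>\<in>space M. P (\<theta> i \<omega>, X i \<omega>)} = space M - {\<omega>\<in>space M. \<theta> i \<omega> = \<mu> \<and> x < X i \<omega>}"
        by (auto simp: P_def)
      then show "prob {\<omega>\<in>space M. P (\<theta> i \<omega>, X i \<omega>)} = 1 - \<epsilon> * (1 - \<Phi> (x - \<mu>))"
        by (simp add: prob_compl prob_shift_and_greater[OF i] prob_shift[OF i])
    qed
    finally show ?thesis
      by simp
  qed
  have h_measurable: "h i \<in> borel_measurable (shift_algebra M \<theta>)" if "i \<ge> 1" for i
    unfolding h_def using that
    by (intro borel_measurable_divide borel_measurable_sum
        measurable_compose[OF measurable_\<theta>_shift_algebra] borel_measurable_indicator) auto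
  have h_nonneg: "0 \<le> h i \<omega>" for i \<omega>
    unfolding h_def by (intro divide_nonneg_nonneg sum_nonneg) auto
  \<comment> \<open>Only an inequality, since without false nulls all weights are
    \<open>0 / 0 = 0\<close>.\<close>
  have sum_h: "(\<Sum>i=1..n. h i \<omega>) \<le> 1" for \<omega>
    by (simp add: h_def sum_divide_distrib[symmetric])
  have h_le: "h i \<omega> \<le> 1" if "i \<in> {1..n}" for i \<omega>
    using sum_h[of \<omega>] member_le_sum[of i "{1..n}" "\<lambda>i. h i \<omega>"] that h_nonneg by force
  have h_borel: "h i \<in> borel_measurable M" if "i \<in> {1..n}" for i
    using that by (intro measurable_from_subalg[OF subalgebra_shift_algebra h_measurable]) simp
  have int_h: "integrable M (h i)" if "i \<in> {1..n}" for i
    using h_borel[OF that] h_le[OF that] h_nonneg by (intro integrable_const_bound[of _ 1] AE_I2) auto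
  have meas_le: "{\<omega>\<in>space M. X i \<omega> \<le> x} \<in> sets M" if "i \<in> {1..n}" for i
  proof -
    have [measurable]: "X i \<in> borel_measurable M"
      using measurable_X that by auto
    show ?thesis
      by measurable
  qed
  have int_hX: "integrable M (\<lambda>\<omega>. h i \<omega> * indicator {\<omega>\<in>space M. X i \<omega> \<le> x} \<omega>)"
    if "i \<in> {1..n}" for i
    using integrable_mult_indicator[OF meas_le[OF that] int_h[OF that]]
    by (simp add: mult.commute)
  have int_W: "integrable M (\<lambda>\<omega>. indicator (\<Union>t\<le>n. W t) \<omega> :: real)"
    by (intro integrable_real_indicator) (auto simp: less_top[symmetric])
  have "lord_fnr M \<Phi> \<mu> \<theta> X lam n
      \<le> (\<integral>\<omega>. indicator (\<Union>t\<le>n. W t) \<omega>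
          + (\<Sum>i=1..n. h i \<omega> * indicator {\<omega>\<in>space M. X i \<omega> \<le> x} \<omega>) \<partial>M)"
    unfolding lord_fnr_def fnr_def p_def[symmetric] R_def[symmetric] F_def[symmetric]
  proof (rule integral_mono')
    show "integrable M (\<lambda>\<omega>. indicator (\<Union>t\<le>n. W t) \<omega>
        + (\<Sum>i=1..n. h i \<omega> * indicator {\<omega>\<in>space M. X i \<omega> \<le> x} \<omega>))"
      using int_W int_hX by (intro Bochner_Integration.integrable_add Bochner_Integration.integrable_sum)
  next
    fix \<omega> assume \<omega>: "\<omega> \<in> space M"
    let ?S = "\<Sum>i=1..n. h i \<omega> * indicator {\<omega>\<in>space M. X i \<omega> \<le> x} \<omega>"
    have S: "0 \<le> ?S"
      using h_nonneg by (intro sum_nonneg) auto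
    then show "0 \<le> indicator (\<Union>t\<le>n. W t) \<omega> + ?S"
      by simp
    have F: "finite (F \<omega>)"
      by (simp add: F_def false_nulls_def)
    show "real (card (F \<omega> - R \<omega>)) / real (card (F \<omega>)) \<le> indicator (\<Union>t\<le>n. W t) \<omega> + ?S"
    proof (cases "\<omega> \<in> (\<Union>t\<le>n. W t)")
      case True
      have "card (F \<omega> - R \<omega>) \<le> card (F \<omega>)"
        using F by (intro card_mono) auto
      then have "real (card (F \<omega> - R \<omega>)) / real (card (F \<omega>)) \<le> 1"
        by (cases "card (F \<omega>) = 0") (simp_all add: divide_le_eq)
      then show ?thesis
        using True S by simp
    next
      case False
      have p: "p \<omega> i \<le> lam L" if "x \<le> X i \<omega>" for i
        using L \<Phi>_mono[OF that] by (simp add: p_def p_value_def)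
      have windows: "\<exists>i\<in>{t<..t+L}. p \<omega> i \<le> lam L" if "t \<le> n" for t
      proof -
        have "\<omega> \<notin> W t"
          using False that by blast
        then obtain i where "i \<in> {t<..t+L}" "x < X i \<omega>"
          unfolding W_def using \<omega> by blast
        then show ?thesis
          using p[of i] by (intro bexI[of _ i]) auto
      qed
      have missed: "X i \<omega> \<le> x" if "i \<in> F \<omega> - R \<omega>" for i
      proof (rule ccontr)
        assume "\<not> X i \<omega> \<le> x"
        moreover have i: "i \<in> {1..n}"
          using that by (auto simp: F_def false_nulls_def)
        ultimately have "p \<omega> i \<le> lord_level lam (R \<omega>) i"
          using p[of i] lord_level_ge[OF windows i] by (simp add: R_def)
        then show False
          using that mem_lord_rejected_iff[OF i] by (simp add: R_def)
      qed
      have "real (card (F \<omega> - R \<omega>)) / card (F \<omega>) = (\<Sum>i\<in>F \<omega> - R \<omega>. 1 / card (F \<omega>))"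
        by simp
      also have "\<dots> \<le> (\<Sum>i\<in>F \<omega> - R \<omega>. h i \<omega> * indicator {\<omega>\<in>space M. X i \<omega> \<le> x} \<omega>)"
        using missed \<omega> by (intro sum_mono) (auto simp: h_def card_F, auto simp: F_def false_nulls_def)
      also have "\<dots> \<le> ?S"
        using h_nonneg by (intro sum_mono2) (auto simp: F_def false_nulls_def)
      finally show ?thesis
        using False by simp
    qed
  qed
  also have "\<dots> = prob (\<Union>t\<le>n. W t)
      + (\<Sum>i=1..n. \<integral>\<omega>. h i \<omega> * indicator {\<omega>\<in>space M. X i \<omega> \<le> x} \<omega> \<partial>M)"
  proof -
    have sum: "integrable M (\<lambda>\<omega>. \<Sum>i=1..n. h i \<omega> * indicator {\<omega>\<in>space M. X i \<omega> \<le> x} \<omega>)"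
      using int_hX by (rule Bochner_Integration.integrable_sum)
    have "(\<integral>\<omega>. (\<Sum>i=1..n. h i \<omega> * indicator {\<omega>\<in>space M. X i \<omega> \<le> x} \<omega>) \<partial>M)
        = (\<Sum>i=1..n. \<integral>\<omega>. h i \<omega> * indicator {\<omega>\<in>space M. X i \<omega> \<le> x} \<omega> \<partial>M)"
      using int_hX by (rule Bochner_Integration.integral_sum)
    moreover have "(\<integral>\<omega>. indicator (\<Union>t\<le>n. W t) \<omega> \<partial>M) = prob (\<Union>t\<le>n. W t)"
      by (simp add: Int_absorb2 sets.sets_into_space)
    ultimately show ?thesis
      using Bochner_Integration.integral_add[OF int_W sum] by (simp only:)
  qed
  also have "(\<Sum>i=1..n. \<integral>\<omega>. h i \<omega> * indicator {\<omega>\<in>space M. X i \<omega> \<le> x} \<omega> \<partial>M)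
      = (\<Sum>i=1..n. \<Phi> (x - \<mu>) * (\<integral>\<omega>. h i \<omega> \<partial>M))"
  proof (rule sum.cong[OF refl])
    fix i assume i: "i \<in> {1..n}"
    have "(\<integral>\<omega>. h i \<omega> * indicator {\<omega>\<in>space M. X i \<omega> \<le> x} \<omega> \<partial>M)
        = (\<integral>\<omega>. h i \<omega> * \<Phi> (x - \<theta> i \<omega>) \<partial>M)"
    proof -
      have "h i \<in> borel_measurable (shift_algebra M \<theta>)" "\<bar>h i \<omega>\<bar> \<le> 1" for \<omega>
        using h_measurable h_le h_nonneg i by auto
      from integral_cond_law[OF this, of "{i}" "\<lambda>_. x"] show ?thesis
        using i by simp
    qed
    \<comment> \<open>\<open>h i\<close> vanishes unless the shift is \<mu>, so the conditional
      probability may be replaced by a constant.\<close>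
    also have "\<dots> = (\<integral>\<omega>. \<Phi> (x - \<mu>) * h i \<omega> \<partial>M)"
      by (intro Bochner_Integration.integral_cong) (auto simp: h_def indicator_def)
    finally show "(\<integral>\<omega>. h i \<omega> * indicator {\<omega>\<in>space M. X i \<omega> \<le> x} \<omega> \<partial>M)
        = \<Phi> (x - \<mu>) * (\<integral>\<omega>. h i \<omega> \<partial>M)"
      by simp
  qed
  also have "\<dots> = \<Phi> (x - \<mu>) * (\<integral>\<omega>. (\<Sum>i=1..n. h i \<omega>) \<partial>M)"
    using int_h by (simp add: Bochner_Integration.integral_sum sum_distrib_left)
  also have "\<dots> \<le> \<Phi> (x - \<mu>) * 1"
    using int_h sum_h \<Phi>_nonneg
    by (intro mult_left_mono integral_le_const AE_I2 Bochner_Integration.integrable_sum) auto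
  also have "prob (\<Union>t\<le>n. W t) \<le> (\<Sum>t\<le>n. prob (W t))"
    by (intro measure_subadditive_finite) auto
  also have "\<dots> = real (n + 1) * (1 - \<epsilon> * (1 - \<Phi> (x - \<mu>))) ^ L"
    by (simp add: prob_W)
  finally show ?thesis
    by simp
qed

end

section \<open>Asymptotics\<close>

text \<open>Summation forces \<open>c\<close> to be \<open>q\<close> divided by the zeta value at
  \<nu>; its positivity makes the levels nonnegative and antitone.\<close>

lemma zipf_lord_levels:
  fixes lam :: "nat \<Rightarrow> real"
  assumes lam: "\<And>i. i \<ge> 1 \<Longrightarrow> lam i = c * real i powr (- \<nu>)" and "\<nu> > 1"
    and sums: "(\<lambda>i. lam (Suc i)) sums q" and "q > 0"
  shows "lord_levels lam q" "c = q / (\<Sum>i. real (Suc i) powr (- \<nu>))"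
    and "(\<Sum>i. real (Suc i) powr (- \<nu>)) > 0"
proof -
  have Z: "summable (\<lambda>i. real (Suc i) powr (- \<nu>))"
    using \<open>\<nu> > 1\<close> by (subst summable_Suc_iff) (simp add: summable_real_powr_iff)
  then show pos: "(\<Sum>i. real (Suc i) powr (- \<nu>)) > 0"
    by (intro suminf_pos) simp_all
  have "(\<lambda>i. c * real (Suc i) powr (- \<nu>)) sums (c * (\<Sum>i. real (Suc i) powr (- \<nu>)))"
    using Z by (intro sums_mult summable_sums)
  then have q: "c * (\<Sum>i. real (Suc i) powr (- \<nu>)) = q"
    using sums lam by (simp add: sums_unique2)
  then show c: "c = q / (\<Sum>i. real (Suc i) powr (- \<nu>))"
    using pos by (simp add: field_simps)
  have "c > 0"
    unfolding c using pos \<open>q > 0\<close> by simp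
  show "lord_levels lam q"
  proof
    show "0 \<le> lam i" if "i \<ge> 1" for i
      using \<open>c > 0\<close> that by (simp add: lam)
    then have "(\<Sum>i<m. lam (Suc i)) \<le> q" for m
      using sum_le_suminf[OF sums_summable[OF sums], of "{..<m}"] sums_unique[OF sums] by simp
    then show "(\<Sum>j=1..m. lam j) \<le> q" for m
      by (simp add: sum.atLeast1_atMost_eq)
    show "lam j \<le> lam i" if "1 \<le> i" "i \<le> j" for i j
      using \<open>c > 0\<close> \<open>\<nu> > 1\<close> that by (simp add: lam powr_mono2')
  qed
qed

text \<open>At this point \<open>x powr \<gamma>\<close> equals \<open>\<gamma> * s * ln n\<close>,
  so the AGG limit makes the log survival asymptotic to \<open>- s * ln n\<close>; passing from
  \<open>s\<close> to the smaller \<open>s'\<close> absorbs the error.\<close>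

lemma agg_survival_le:
  assumes agg: "agg_right \<Phi> \<gamma>" and s: "0 < s'" "s' < s"
  shows "eventually (\<lambda>n. 1 - \<Phi> ((\<gamma> * s * ln (real n)) powr (1 / \<gamma>)) \<le> real n powr (- s')) sequentially"
proof -
  have \<gamma>: "\<gamma> > 0" and lim: "((\<lambda>x. x powr (- \<gamma>) * ln (1 - \<Phi> x)) \<longlongrightarrow> - 1 / \<gamma>) at_top"
    using agg by (auto simp: agg_right_def)
  define x where "x n = (\<gamma> * s * ln (real n)) powr (1 / \<gamma>)" for n :: nat
  have "filterlim x at_top sequentially"
    unfolding x_def using \<gamma> s by real_asymp
  then have "(\<lambda>n. x n powr (- \<gamma>) * ln (1 - \<Phi> (x n))) \<longlonglongrightarrow> - 1 / \<gamma>"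
    by (rule filterlim_compose[OF lim])
  moreover have "- 1 / \<gamma> < - (s' / s) / \<gamma>"
    using \<gamma> s by (simp add: field_simps)
  ultimately have "eventually (\<lambda>n. x n powr (- \<gamma>) * ln (1 - \<Phi> (x n)) < - (s' / s) / \<gamma>) sequentially"
    by (rule order_tendstoD)
  then show ?thesis
    using eventually_ge_at_top[of 2]
  proof eventually_elim
    case (elim n)
    have ln: "ln (real n) > 0"
      using elim by simp
    have K: "\<gamma> * s * ln (real n) > 0"
      using \<gamma> s ln by simp
    have "x n powr (- \<gamma>) = 1 / (\<gamma> * s * ln (real n))"
      using \<gamma> K by (simp add: x_def powr_powr powr_minus_divide)
    then have "ln (1 - \<Phi> (x n)) / (\<gamma> * s * ln (real n)) < - (s' / s) / \<gamma>"
      using elim(1) by simp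
    then have "ln (1 - \<Phi> (x n)) < - (s' / s) / \<gamma> * (\<gamma> * s * ln (real n))"
      using K by (simp only: pos_divide_less_eq)
    also have "\<dots> = - s' * ln (real n)"
      using \<gamma> s by simp
    finally have ln_less: "ln (1 - \<Phi> (x n)) < - s' * ln (real n)" .
    have "1 - \<Phi> (x n) \<le> real n powr (- s')"
    \<comment> \<open>The logarithm can be inverted only for a positive argument; otherwise the
      bound is immediate.\<close>
    proof (cases "1 - \<Phi> (x n) > 0")
      case True
      then have "1 - \<Phi> (x n) = exp (ln (1 - \<Phi> (x n)))"
        by simp
      also have "\<dots> \<le> exp (- s' * ln (real n))"
        using ln_less by simp
      also have "\<dots> = real n powr (- s')"
        using elim by (simp add: powr_def)
      finally show ?thesis .
    next
      case False
      then have "1 - \<Phi> (x n) \<le> 0"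
        by simp
      also have "\<dots> \<le> real n powr (- s')"
        by simp
      finally show ?thesis .
    qed
    then show ?case
      by (simp add: x_def)
  qed
qed

text \<open>Both terms share the divergent factor
  \<open>(\<gamma> * ln n) powr (1 / \<gamma>)\<close>, and the remaining constant factor is
  negative because \<open>s < r\<close>.\<close>

lemma powr_diff_at_bot:
  fixes \<gamma> s r :: real
  assumes "\<gamma> > 0" "0 < s" "s < r"
  shows "filterlim (\<lambda>n. (\<gamma> * s * ln (real n)) powr (1 / \<gamma>) - (\<gamma> * r * ln (real n)) powr (1 / \<gamma>))
    at_bot sequentially"
proof -
  define d where "d = r powr (1 / \<gamma>) - s powr (1 / \<gamma>)"
  have "d > 0"
    unfolding d_def using assms by (simp add: powr_less_mono2)
  have "filterlim (\<lambda>n. - ((\<gamma> * ln (real n)) powr (1 / \<gamma>) * d)) at_bot sequentially"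
    using \<open>d > 0\<close> \<open>\<gamma> > 0\<close> by real_asymp
  also have "?this \<longleftrightarrow> ?thesis"
  proof (rule filterlim_cong[OF refl refl])
    show "eventually (\<lambda>n. - ((\<gamma> * ln (real n)) powr (1 / \<gamma>) * d)
      = (\<gamma> * s * ln (real n)) powr (1 / \<gamma>) - (\<gamma> * r * ln (real n)) powr (1 / \<gamma>)) sequentially"
      using eventually_ge_at_top[of 1]
    proof eventually_elim
      case (elim n)
      then have "0 \<le> ln (real n)"
        by simp
      then have "(\<gamma> * t * ln (real n)) powr (1 / \<gamma>) = (\<gamma> * ln (real n)) powr (1 / \<gamma>) * t powr (1 / \<gamma>)"
        if "t > 0" for t
        using that \<open>\<gamma> > 0\<close> powr_mult[of "\<gamma> * ln (real n)" t "1 / \<gamma>"] by (simp add: mult_ac)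
      then show ?case
        using assms by (simp add: d_def right_diff_distrib)
    qed
  qed
  finally show ?thesis .
qed

(* The mixture model is required for n >= 2 only: at n = 1 the shift is 0, so that
   P(shift = mu) = 1 and P(shift = 0) = 0 would contradict each other. *)
theorem theorem1:
  fixes D :: "real measure" and \<Phi> :: "real \<Rightarrow> real"
    and \<gamma> \<beta> r \<nu> :: real
    and q \<epsilon> \<mu> :: "nat \<Rightarrow> real"
    and lam :: "nat \<Rightarrow> nat \<Rightarrow> real"
    and M :: "nat \<Rightarrow> 'a measure"
    and \<theta> X :: "nat \<Rightarrow> nat \<Rightarrow> 'a \<Rightarrow> real"
  assumes "real_distribution D" and "\<Phi> = cdf D"
    and "continuous_on UNIV \<Phi>"
    and "agg_right \<Phi> \<gamma>" and "\<gamma> \<ge> 1"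
    and "0 < \<beta>" and "\<beta> < 1" and "r \<ge> 0" and "\<nu> > 1"
    and "\<And>n. n \<ge> 1 \<Longrightarrow> q n > 0"
    and "\<And>a. a > 0 \<Longrightarrow> filterlim (\<lambda>n. real n powr a * q n) at_top sequentially"
    and "\<And>n. \<epsilon> n = real n powr (- \<beta>)"
    and "\<And>n. \<mu> n = (\<gamma> * r * ln (real n)) powr (1 / \<gamma>)"
    and "\<And>n. n \<ge> 2 \<Longrightarrow> static_mixture (M n) \<Phi> (\<epsilon> n) (\<mu> n) (\<theta> n) (X n)"
    and "\<And>n. n \<ge> 1 \<Longrightarrow> \<exists>c. \<forall>i\<ge>1. lam n i = c * real i powr (- \<nu>)"
    and "\<And>n. n \<ge> 1 \<Longrightarrow> (\<lambda>i. lam n (Suc i)) sums q n"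
    and "r > \<nu> * \<beta>"
  shows "(\<lambda>n. lord_fnr (M n) \<Phi> (\<mu> n) (\<theta> n) (X n) (lam n) n) \<longlonglongrightarrow> 0 \<and>
    (q \<longlonglongrightarrow> 0 \<longrightarrow>
      (\<lambda>n. lord_fdr (M n) \<Phi> (\<mu> n) (\<theta> n) (X n) (lam n) n
         + lord_fnr (M n) \<Phi> (\<mu> n) (\<theta> n) (X n) (lam n) n) \<longlonglongrightarrow> 0)"
proof -
  note D = assms(1) and \<Phi> = assms(2) and cont = assms(3) and agg = assms(4)
  note \<beta>0 = assms(6) and \<nu> = assms(9) and q_pos = assms(10) and q_large = assms(11)
    and \<epsilon> = assms(12) and \<mu> = assms(13) and mixture = assms(14) and r = assms(17)
  interpret D: real_distribution D
    by (rule D)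
  have \<gamma>: "\<gamma> > 0"
    using assms(5) by simp
  have r_pos: "r > 0"
    using \<beta>0 \<nu> r by (intro less_trans[OF _ r]) simp
  \<comment> \<open>The gap above \<beta> makes the expected number of false nulls per block
    diverge. The gaps in \<open>\<nu> * b < s' < s < r\<close> absorb, in turn, \<open>q\<close>
    with the constants, the error in the AGG limit, and the chance that a false null stays below the
    threshold.\<close>
  obtain b where "\<beta> < b" "b < r / \<nu>"
    using r \<nu> dense[of \<beta> "r / \<nu>"] by (auto simp: field_simps)
  then have b: "\<beta> < b" "\<nu> * b < r"
    using \<nu> by (auto simp: field_simps)
  obtain s where s: "\<nu> * b < s" "s < r"
    using dense[OF b(2)] by blast
  obtain s' where s': "\<nu> * b < s'" "s' < s"
    using dense[OF s(1)] by blast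
  have "0 < \<nu> * b"
    using \<nu> b \<beta>0 by simp
  define Z where "Z = (\<Sum>i. real (Suc i) powr (- \<nu>))"
  define L where "L n = nat \<lceil>real n powr b\<rceil>" for n :: nat
  define x where "x n = (\<gamma> * s * ln (real n)) powr (1 / \<gamma>)" for n :: nat
  define \<delta> where "\<delta> n = \<Phi> (x n - \<mu> n)" for n
  define e where "e = b - \<beta>"
  let ?fdr = "\<lambda>n. lord_fdr (M n) \<Phi> (\<mu> n) (\<theta> n) (X n) (lam n) n"
  let ?fnr = "\<lambda>n. lord_fnr (M n) \<Phi> (\<mu> n) (\<theta> n) (X n) (lam n) n"

  have levels: "lord_levels (lam n) (q n)" "Z > 0"
    "i \<ge> 1 \<Longrightarrow> lam n i = q n / Z * real i powr (- \<nu>)" if n: "n \<ge> 1" for n i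
  proof -
    obtain c where c: "\<And>i. i \<ge> 1 \<Longrightarrow> lam n i = c * real i powr (- \<nu>)"
      using assms(15)[OF n] by blast
    note zipf = zipf_lord_levels[OF c \<nu> assms(16)[OF n] q_pos[OF n]]
    show "lord_levels (lam n) (q n)" "Z > 0"
      using zipf(1,3) by (simp_all add: Z_def)
    show "lam n i = q n / Z * real i powr (- \<nu>)" if "i \<ge> 1"
      using c[OF that] zipf(2) by (simp add: Z_def)
  qed
  \<comment> \<open>From \<open>n = 2\<close> on the logarithm is positive, so the shift is
    nonzero.\<close>
  have cdf_mixture: "cdf_mixture (M n) \<Phi> (\<epsilon> n) (\<mu> n) (\<theta> n) (X n) D" if n: "n \<ge> 2" for n
    unfolding cdf_mixture_def cdf_mixture_axioms_def
    using mixture[OF n] D \<Phi> cont \<gamma> r_pos n by (simp add: \<mu>)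

  have "(\<lambda>n. x n - \<mu> n) = (\<lambda>n. (\<gamma> * s * ln (real n)) powr (1 / \<gamma>) - (\<gamma> * r * ln (real n)) powr (1 / \<gamma>))"
    by (simp add: x_def \<mu>)
  then have "filterlim (\<lambda>n. x n - \<mu> n) at_bot sequentially"
    using powr_diff_at_bot[of \<gamma> s r] \<gamma> s \<open>0 < \<nu> * b\<close> by simp
  then have \<delta>: "\<delta> \<longlonglongrightarrow> 0"
    unfolding \<delta>_def \<Phi> by (rule filterlim_compose[OF D.cdf_lim_at_bot])

  \<comment> \<open>\<open>Z\<close> is the normalisation of the levels, and
    \<open>2 powr \<nu>\<close> pays for rounding the block length, which is at most
    \<open>2 * n powr b\<close>.\<close>
  have "eventually (\<lambda>n. real n powr (s' - \<nu> * b) * q n \<ge> 2 powr \<nu> * Z) sequentially"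
    using q_large[of "s' - \<nu> * b"] s' by (simp add: filterlim_at_top)
  moreover have "eventually (\<lambda>n. 1 - \<Phi> (x n) \<le> real n powr (- s')) sequentially"
    unfolding x_def using s' \<open>0 < \<nu> * b\<close> by (intro agg_survival_le[OF agg]) auto
  moreover have "eventually (\<lambda>n. \<delta> n < 1 / 2) sequentially"
    using \<delta> by (rule order_tendstoD) simp
  ultimately have fnr_le: "eventually (\<lambda>n. ?fnr n
      \<le> real (n + 1) * exp (- (real n powr e) / 2) + \<delta> n) sequentially"
    using eventually_ge_at_top[of 2]
  proof eventually_elim
    case (elim n)
    interpret cdf_mixture "M n" \<Phi> "\<epsilon> n" "\<mu> n" "\<theta> n" "X n" D
      by (rule cdf_mixture) fact
    note Z = levels(2)[of n] and lam = levels(3)[of n "L n"]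
    have n: "n \<ge> 1" "real n > 0"
      using elim by auto
    have pow_b: "real n powr b \<ge> 1"
      using n b \<beta>0 by (intro ge_one_powr_ge_zero) auto
    have L: "real n powr b \<le> L n" "L n \<le> 2 * real n powr b" "L n \<ge> 1"
      using pow_b unfolding L_def by linarith+
    \<comment> \<open>This chain ends at \<open>lam n (L n)\<close>, which places the survival
      function at \<open>x n\<close> below the level required by \<open>lord_fnr_le\<close>.\<close>
    have "real n powr (- s') * (2 powr \<nu> * Z) \<le> real n powr (- s') * (real n powr (s' - \<nu> * b) * q n)"
      using elim(1) by (intro mult_left_mono) auto
    also have "\<dots> = q n * real n powr (- (\<nu> * b))"
      by (simp add: mult.assoc[symmetric] powr_add[symmetric])
    finally have "real n powr (- s') \<le> q n / Z * (2 powr (- \<nu>) * real n powr (- (\<nu> * b)))"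
      using Z n by (simp add: field_simps powr_minus)
    also have "2 powr (- \<nu>) * real n powr (- (\<nu> * b)) = (2 * real n powr b) powr (- \<nu>)"
      using n by (simp add: powr_mult powr_powr mult.commute)
    also have "q n / Z * (2 * real n powr b) powr (- \<nu>) \<le> q n / Z * real (L n) powr (- \<nu>)"
      using L \<nu> Z n q_pos[of n] by (intro mult_left_mono powr_mono2') auto
    also have "\<dots> = lam n (L n)"
      using lam n L by simp
    finally have "1 - \<Phi> (x n) \<le> lam n (L n)"
      using elim(2) by linarith
    then have "?fnr n \<le> real (n + 1) * (1 - \<epsilon> n * (1 - \<delta> n)) ^ L n + \<delta> n"
      unfolding \<delta>_def using n by (intro lord_fnr_le[OF levels(1)])
    also have "(1 - \<epsilon> n * (1 - \<delta> n)) ^ L n \<le> exp (- (real n powr e) / 2)"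
    proof -
      have \<epsilon>01: "0 \<le> \<epsilon> n" "\<epsilon> n \<le> 1"
        using n \<beta>0 powr_mono[of "- \<beta>" 0 "real n"] by (auto simp: \<epsilon>)
      \<comment> \<open>The first bound gives the decay; the second keeps the base nonnegative, so
        that powers may be compared.\<close>
      have "\<epsilon> n * (1 / 2) \<le> \<epsilon> n * (1 - \<delta> n)" "\<epsilon> n * (1 - \<delta> n) \<le> 1 * 1"
        using \<epsilon>01 elim(3) \<Phi>_nonneg \<Phi>_le_1
        by (intro mult_left_mono mult_mono; simp add: \<delta>_def)+
      moreover have "1 - \<epsilon> n / 2 \<le> exp (- \<epsilon> n / 2)"
        using exp_ge_add_one_self[of "- \<epsilon> n / 2"] by simp
      ultimately have "(1 - \<epsilon> n * (1 - \<delta> n)) ^ L n \<le> exp (- \<epsilon> n / 2) ^ L n"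
        by (intro power_mono) linarith+
      also have "\<dots> = exp (- (\<epsilon> n * L n) / 2)"
        by (simp add: exp_of_nat_mult[symmetric] mult.commute)
      also have "\<epsilon> n * L n \<ge> \<epsilon> n * real n powr b"
        using \<epsilon>01 L by (intro mult_left_mono)
      then have "exp (- (\<epsilon> n * L n) / 2) \<le> exp (- (\<epsilon> n * real n powr b) / 2)"
        by simp
      also have "\<epsilon> n * real n powr b = real n powr e"
        by (simp add: \<epsilon> e_def powr_add[symmetric])
      finally show ?thesis .
    qed
    finally show ?case
      by (simp add: mult_left_mono)
  qed
  \<comment> \<open>A positive \<open>e\<close> lets the stretched exponential beat the factor
    \<open>n + 1\<close> from the union bound.\<close>
  have "e > 0"
    using b by (simp add: e_def)
  then have "(\<lambda>n. real (n + 1) * exp (- (real n powr e) / 2)) \<longlonglongrightarrow> 0"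
    by real_asymp
  then have bound: "(\<lambda>n. real (n + 1) * exp (- (real n powr e) / 2) + \<delta> n) \<longlonglongrightarrow> 0"
    using tendsto_add[OF _ \<delta>] by force
  have "eventually (\<lambda>n. 0 \<le> ?fnr n) sequentially"
    by (rule eventually_sequentiallyI[of 2]) (rule cdf_mixture.fnr_nonneg[OF cdf_mixture])
  then have fnr: "?fnr \<longlonglongrightarrow> 0"
    by (rule tendsto_sandwich[OF _ fnr_le tendsto_const bound])
  moreover have "(\<lambda>n. ?fdr n + ?fnr n) \<longlonglongrightarrow> 0" if "q \<longlonglongrightarrow> 0"
  proof -
    have "eventually (\<lambda>n. 0 \<le> ?fdr n) sequentially"
      by (rule eventually_sequentiallyI[of 2]) (rule cdf_mixture.fdr_nonneg[OF cdf_mixture])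
    moreover have "eventually (\<lambda>n. ?fdr n \<le> 2 * q n) sequentially"
      by (rule eventually_sequentiallyI[of 2])
        (simp add: cdf_mixture.lord_fdr_le[OF cdf_mixture] levels(1))
    ultimately have "?fdr \<longlonglongrightarrow> 0"
      by (rule tendsto_sandwich[OF _ _ tendsto_const tendsto_mult_right_zero[OF that]])
    then show ?thesis
      using tendsto_add[OF _ fnr] by simp
  qed
  ultimately show ?thesis
    by blast
qed

end
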